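(* Let $1<p<\infty$, $p\neq 2$, let $X=\ell_p^3$, and let $A$ and $B$ be two-dimensional subspaces of $X$ chosen independently and uniformly at random. Then $P_A$ and $P_B$ are linear, but $\mathbb{P}(P_{A\cap B}\text{ is linear})=0$.
   Context: $\ell_p^3=(\mathbb{R}^3,\|\cdot\|_p)$ with $\|x\|_p=\left(\sum_{i=1}^3|x_i|^p\right)^{1/p}$. For a linear subspace $L$, the metric projection $P_L\colon\ell_p^3\to\ell_p^3$ sends $x$ to the unique point $P_Lx\in L$ with $\|x-P_Lx\|_p=\min_{y\in L}\|x-y\|_p$. A two-dimensional subspace $A$ of $\mathbb{R}^3$ is chosen uniformly at random if it is the Euclidean orthogonal complement $A=\{x\in\mathbb{R}^3:\langle a,x\rangle=0\}$ of a random vector $a$ chosen according to the uniform distribution on the Euclidean unit sphere; here $\langle\cdot,\cdot\rangle$ is the standard inner product. *)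

theory Defs
  imports "HOL-Probability.Probability"
begin

definition lp_norm :: "real \<Rightarrow> real^'n \<Rightarrow> real" where
  "lp_norm p x = (\<Sum>i\<in>UNIV. \<bar>x $ i\<bar> powr p) powr (1 / p)"

text \<open>The definite description is meaningful because nearest points in a linear subspace
  exist and are unique for \<open>1 < p < \<infinity>\<close>.\<close>

definition metric_proj :: "real \<Rightarrow> (real^'n) set \<Rightarrow> real^'n \<Rightarrow> real^'n" where
  "metric_proj p L x =
    (THE y. y \<in> L \<and> (\<forall>z\<in>L. lp_norm p (x - y) \<le> lp_norm p (x - z)))"

definition orth_compl :: "real^'n \<Rightarrow> (real^'n) set" where
  "orth_compl a = {x. a \<bullet> x = 0}"

text \<open>The uniform distribution on the Euclidean unit sphere, as the law of \<open>x / \<parallel>x\<parallel>\<close> for \<open>x\<close>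
  uniform in the unit ball.  The origin, where \<open>x /\<^sub>R norm x = 0\<close>, is a null set.  The
  underlying space of the measure is the sphere itself, with its Borel sets, and the lemmas
  below confirm that it is a probability measure and, on \<open>\<real>\<^sup>3\<close>, invariant under orthogonal maps,
  which characterises it.\<close>

definition uniform_sphere :: "(real^'n) measure" where
  "uniform_sphere =
    restrict_space
      (distr (uniform_measure lborel (ball 0 1)) borel (\<lambda>x. x /\<^sub>R norm x))
      (sphere 0 1)"

lemma space_uniform_sphere [simp]: "space uniform_sphere = sphere 0 1"
  by (simp add: uniform_sphere_def space_restrict_space)

lemma sets_uniform_sphere [simp]:
  "sets uniform_sphere = sets (restrict_space borel (sphere 0 1))"
  by (simp add: uniform_sphere_def sets_restrict_space)

lemma emeasure_uniform_sphere:
  fixes E :: "(real^'n) set"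
  assumes "E \<in> sets uniform_sphere"
  shows "emeasure uniform_sphere E =
    emeasure lborel {x \<in> ball 0 1. x /\<^sub>R norm x \<in> E} / emeasure lborel (ball (0::real^'n) 1)"
proof -
  have E: "E \<in> sets borel" "E \<subseteq> sphere 0 1"
    using assms by (auto simp: sets_restrict_space_iff)
  have m: "(\<lambda>x::real^'n. x /\<^sub>R norm x) \<in> borel_measurable borel" by measurable
  have pre: "(\<lambda>x::real^'n. x /\<^sub>R norm x) -` E \<in> sets borel"
    using measurable_sets[OF m E(1)] by simp
  have "emeasure uniform_sphere E =
      emeasure (distr (uniform_measure lborel (ball 0 1)) borel (\<lambda>x. x /\<^sub>R norm x)) E"
    unfolding uniform_sphere_def using E by (subst emeasure_restrict_space) auto
  also have "\<dots> = emeasure (uniform_measure lborel (ball 0 1)) ((\<lambda>x. x /\<^sub>R norm x) -` E)"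
    using E m by (subst emeasure_distr) (auto simp: measurable_def)
  also have "\<dots> = emeasure lborel (ball 0 1 \<inter> (\<lambda>x. x /\<^sub>R norm x) -` E) / emeasure lborel (ball (0::real^'n) 1)"
    using pre by (subst emeasure_uniform_measure) auto
  also have "ball 0 1 \<inter> (\<lambda>x. x /\<^sub>R norm x) -` E = {x \<in> ball 0 1. x /\<^sub>R norm x \<in> E}" by auto
  finally show ?thesis .
qed

lemma emeasure_lborel_unit_ball:
  "emeasure lborel (ball (0::real^'n) 1) \<noteq> 0" "emeasure lborel (ball (0::real^'n) 1) \<noteq> \<infinity>"
proof -
  show "emeasure lborel (ball (0::real^'n) 1) \<noteq> 0"
    using content_ball_pos[of 1 "0::real^'n"] by (auto simp: measure_def)
  show "emeasure lborel (ball (0::real^'n) 1) \<noteq> \<infinity>"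
    using emeasure_bounded_finite[of "ball (0::real^'n) 1"] by auto
qed

lemma prob_space_uniform_sphere: "prob_space (uniform_sphere :: (real^'n) measure)"
proof
  let ?S = "sphere (0::real^'n) 1"
  have 0: "{0::real^'n} \<in> null_sets lborel"
    by (rule null_setsI) auto
  have eq: "{x \<in> ball (0::real^'n) 1. x /\<^sub>R norm x \<in> ?S} = ball 0 1 - {0}"
    by (auto simp: divide_simps)
  have S: "?S \<in> sets uniform_sphere"
    by (simp add: sets_restrict_space_iff)
  have "emeasure lborel (ball (0::real^'n) 1 - {0}) = emeasure lborel (ball (0::real^'n) 1)"
    by (rule emeasure_Diff_null_set[OF 0]) simp
  then show "emeasure (uniform_sphere :: (real^'n) measure) (space uniform_sphere) = 1"
    using emeasure_uniform_sphere[OF S] emeasure_lborel_unit_ball[where 'n='n] eq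
    by (simp add: ennreal_divide_self top.not_eq_extremum)
qed

lemma uniform_sphere_orthogonal_invariant:
  fixes f :: "real^3 \<Rightarrow> real^3"
  assumes f: "orthogonal_transformation f"
  shows "distr uniform_sphere uniform_sphere f = uniform_sphere"
proof (rule measure_eqI)
  fix E assume "E \<in> sets (distr uniform_sphere uniform_sphere f)"
  then have E: "E \<in> sets uniform_sphere" by simp
  then have E': "E \<in> sets borel" "E \<subseteq> sphere 0 1" by (auto simp: sets_restrict_space_iff)
  have lin: "linear f" using f by (rule orthogonal_transformation_linear)
  have nf: "norm (f x) = norm x" for x using f by (rule orthogonal_transformation_norm)
  have bm: "f \<in> borel_measurable borel"
    using lin by (simp add: borel_measurable_continuous_onI linear_continuous_on linear_linear)
  have fm: "f \<in> measurable uniform_sphere uniform_sphere"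
    by (subst measurable_cong_sets[OF sets_uniform_sphere sets_uniform_sphere])
      (intro measurable_restrict_space3 bm, auto simp: nf)
  let ?C = "\<lambda>E. {x \<in> ball (0::real^3) 1. x /\<^sub>R norm x \<in> E}"
  have C: "?C E \<in> sets borel"
  proof -
    have m: "(\<lambda>x::real^3. x /\<^sub>R norm x) \<in> borel_measurable borel" by measurable
    have "?C E = ball 0 1 \<inter> (\<lambda>x::real^3. x /\<^sub>R norm x) -` E" by auto
    then show ?thesis using measurable_sets[OF m E'(1)] by simp
  qed
  have cone: "?C (f -` E \<inter> sphere 0 1) = f -` ?C E"
    using E'(2) by (auto simp: nf linear_scale[OF lin])
  obtain g where g: "orthogonal_transformation g" "g \<circ> f = id" "f \<circ> g = id"
    using f orthogonal_transformation_inv[OF f] orthogonal_transformation_bij[OF f]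
    by (metis bij_def inv_o_cancel surj_iff)
  have vg: "f -` ?C E = g ` ?C E"
    using g(2,3) by (auto simp: fun_eq_iff image_iff) (metis)+
  have "bounded (?C E)" by (rule bounded_subset[OF bounded_ball[of 0 1]]) auto
  then have lm: "?C E \<in> lmeasurable"
    using C by (intro bounded_set_imp_lmeasurable) auto
  have "measure lebesgue (g ` ?C E) = measure lebesgue (?C E)"
    using measure_orthogonal_image[OF g(1) lm] .
  moreover have "g ` ?C E \<in> lmeasurable" 
    using measurable_orthogonal_image[OF g(1) lm] .
  ultimately have "emeasure lebesgue (g ` ?C E) = emeasure lebesgue (?C E)"
    using lm by (simp add: emeasure_eq_measure2)
  then have "emeasure lborel (f -` ?C E) = emeasure lborel (?C E)"
    using C measurable_sets[OF bm C] unfolding vg by simp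
  moreover have "f -` E \<inter> sphere 0 1 \<in> sets uniform_sphere"
    using measurable_sets[OF fm E] by simp
  ultimately show "emeasure (distr uniform_sphere uniform_sphere f) E = emeasure uniform_sphere E"
    using emeasure_uniform_sphere[OF E] emeasure_uniform_sphere[of "f -` E \<inter> sphere 0 1"] cone
    by (simp add: emeasure_distr[OF fm E])
qed simp

end

theory Submission
  imports Defs
begin

text \<open>
  Write \<open>\<phi>\<^sub>q(s) = sgn s \<cdot> |s|\<^sup>q\<close> (the function \<open>spow q\<close>).  Since \<open>p \<phi>\<^sub>p\<^sub>-\<^sub>1\<close> is the derivative of the
  strictly convex function \<open>|s|\<^sup>p\<close>, a point \<open>y\<close> of a subspace \<open>L\<close> with
  \<open>\<Sum>\<^sub>i \<phi>\<^sub>p\<^sub>-\<^sub>1(x\<^sub>i - y\<^sub>i) z\<^sub>i = 0\<close> for all \<open>z \<in> L\<close> is the unique nearest point to \<open>x\<close>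
  (\<open>metric_proj_eqI\<close>).  Everything about metric projections follows from this criterion, together
  with the facts that \<open>\<phi>\<^sub>q\<close> is odd and multiplicative and that \<open>\<phi>\<^sub>p\<^sub>-\<^sub>1\<close> has the inverse \<open>\<phi>\<^sub>r\<close>,
  where \<open>r = 1/(p - 1)\<close>.

  For the hyperplane \<open>a\<^sup>\<bottom>\<close> the criterion asks \<open>\<phi>\<^sub>p\<^sub>-\<^sub>1(x - y)\<close>, taken coordinatewise, to be a
  multiple of \<open>a\<close>, that is, \<open>x - y\<close> to be a multiple of \<open>\<phi>\<^sub>r(a)\<close>.  So \<open>P\<close> is the linear projection
  onto \<open>a\<^sup>\<bottom>\<close> along \<open>\<phi>\<^sub>r(a)\<close>, in any dimension.

  For a line \<open>\<real>c\<close> the points that \<open>P\<close> sends to \<open>0\<close> include all solutions of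
  \<open>\<Sum>\<^sub>i c\<^sub>i \<phi>\<^sub>p\<^sub>-\<^sub>1(x\<^sub>i) = 0\<close>.  If at most two \<open>c\<^sub>i\<close> are non-zero, two terms cancel exactly when their
  images under \<open>\<phi>\<^sub>r\<close> do, so the equation is the linear equation \<open>\<Sum>\<^sub>i \<phi>\<^sub>r(c\<^sub>i) x\<^sub>i = 0\<close> and \<open>P\<close> is
  linear.  With three non-zero \<open>c\<^sub>i\<close> the solution set is not a subspace: in the coordinates
  \<open>\<phi>\<^sub>r(c\<^sub>i) x\<^sub>i\<close> it contains \<open>(1, 0, -1)\<close>, \<open>(0, 1, -1)\<close> and \<open>(1, 1, -2\<^sup>r)\<close>, and \<open>2\<^sup>r \<noteq> 2\<close> as
  \<open>p \<noteq> 2\<close>.  If \<open>P\<close> were linear, its kernel would then contain every coordinate vector, which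
  contradicts \<open>P c = c\<close>.

  In \<open>\<real>\<^sup>3\<close> two distinct planes \<open>a\<^sup>\<bottom>\<close> and \<open>b\<^sup>\<bottom>\<close> meet in the line spanned by the cross product
  \<open>a \<times> b\<close>, and two equal ones meet in a plane while \<open>a \<times> b = 0\<close>.  In both cases the projection
  onto the intersection is linear if and only if some coordinate of \<open>a \<times> b\<close> vanishes
  (\<open>linear_metric_proj_Int_iff\<close>).  This describes the event exactly, so it is measurable.  For
  fixed \<open>a\<close> off the coordinate planes, each coordinate of \<open>a \<times> b\<close> is a non-zero linear form in
  \<open>b\<close>, so it vanishes with probability zero, and Fubini's theorem gives the claim.
\<close>

section \<open>Signed powers\<close>

definition spow :: "real \<Rightarrow> real \<Rightarrow> real" where
  "spow q s = sgn s * \<bar>s\<bar> powr q"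

lemma spow_0 [simp]: "spow q 0 = 0"
  by (simp add: spow_def)

lemma spow_1 [simp]: "spow q 1 = 1"
  by (simp add: spow_def)

lemma spow_minus [simp]: "spow q (- s) = - spow q s"
  by (simp add: spow_def sgn_minus)

lemma spow_mult: "spow q (s * t) = spow q s * spow q t"
  by (simp add: spow_def sgn_mult abs_mult powr_mult)

lemma spow_spow_inverse:
  assumes "q \<noteq> 0"
  shows "spow q (spow (1 / q) s) = s"
  using assms by (cases "s = 0") (auto simp: spow_def sgn_mult abs_mult powr_powr mult_sgn_abs)

lemma mult_spow_nonneg: "0 \<le> s * spow q s"
  by (auto simp: spow_def sgn_if zero_le_mult_iff)

lemma mult_spow_eq_0_iff: "s * spow q s = 0 \<longleftrightarrow> s = 0"
  by (auto simp: spow_def sgn_if)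

lemma sum_mult_spow_pos:
  fixes x :: "real^'n"
  assumes "x \<noteq> 0"
  shows "0 < (\<Sum>i\<in>UNIV. x $ i * spow q (x $ i))"
proof -
  obtain i where i: "x $ i \<noteq> 0"
    using assms by (auto simp: vec_eq_iff)
  then have "0 < x $ i * spow q (x $ i)"
    using mult_spow_nonneg[of "x $ i" q] mult_spow_eq_0_iff[of "x $ i" q] by linarith
  then show ?thesis
    by (intro sum_pos2[where i = i]) (auto simp: mult_spow_nonneg)
qed

lemma powr_tangent_at_1:
  fixes p u :: real
  assumes p: "1 < p" and u: "0 \<le> u" "u \<noteq> 1"
  shows "1 + p * (u - 1) < u powr p"
proof (cases "u = 0")
  case True
  then show ?thesis using p by simp
next
  case False
  then have u0: "0 < u" using u by simp
  have d: "((\<lambda>x. x powr p) has_real_derivative p * x powr (p - 1)) (at x)" if "0 < x" for x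
    using that by (rule has_real_derivative_powr)
  show ?thesis
  proof (cases "1 < u")
    case True
    obtain z where z: "1 < z" "z < u" "u powr p - 1 powr p = (u - 1) * (p * z powr (p - 1))"
      using MVT2[OF True, of "\<lambda>x. x powr p" "\<lambda>x. p * x powr (p - 1)"] d by force
    have "1 powr (p - 1) < z powr (p - 1)"
      using z p by (intro powr_less_mono2) auto
    then have "(u - 1) * (p * 1) < (u - 1) * (p * z powr (p - 1))"
      using True p by (intro mult_strict_left_mono) auto
    then show ?thesis using z(3) by (simp add: algebra_simps)
  next
    case False
    then have u1: "u < 1" using u by simp
    obtain z where z: "u < z" "z < 1" "1 powr p - u powr p = (1 - u) * (p * z powr (p - 1))"
      using MVT2[OF u1, of "\<lambda>x. x powr p" "\<lambda>x. p * x powr (p - 1)"] d u0 by force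
    have "z powr (p - 1) < 1 powr (p - 1)"
      using z p u0 by (intro powr_less_mono2) auto
    then have "(1 - u) * (p * z powr (p - 1)) < (1 - u) * (p * 1)"
      using u1 p by (intro mult_strict_left_mono) auto
    then show ?thesis using z(3) by (simp add: algebra_simps)
  qed
qed

text \<open>The graph of \<open>|t|\<^sup>p\<close> lies strictly above its tangent at \<open>s\<close>.  By homogeneity only the
  tangent at \<open>1\<close> matters: for \<open>s \<noteq> 0\<close>, divide by \<open>|s|\<^sup>p\<close> and put \<open>u = t / s\<close>.\<close>

lemma abs_powr_tangent:
  fixes p s t :: real
  assumes p: "1 < p" and "t \<noteq> s"
  shows "\<bar>s\<bar> powr p + p * spow (p - 1) s * (t - s) < \<bar>t\<bar> powr p"
proof (cases "s = 0")
  case True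
  then show ?thesis using assms by simp
next
  case False
  define u where "u = t / s"
  have t: "t = s * u" and u: "u \<noteq> 1" using False assms by (auto simp: u_def)
  have "1 + p * (u - 1) < \<bar>u\<bar> powr p"
  proof (cases "0 \<le> u")
    case True
    then show ?thesis using powr_tangent_at_1[OF p _ u] by simp
  next
    case False
    have "0 < p * (- u)" using False p by (intro mult_pos_pos) auto
    then have "1 + p * (u - 1) < 0" using p by (simp add: algebra_simps)
    then show ?thesis using powr_ge_zero[of "\<bar>u\<bar>" p] by linarith
  qed
  then have "\<bar>s\<bar> powr p * (1 + p * (u - 1)) < \<bar>s\<bar> powr p * \<bar>u\<bar> powr p"
    using False by (intro mult_strict_left_mono) auto
  also have "\<dots> = \<bar>t\<bar> powr p" by (simp add: t abs_mult powr_mult)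
  also have "\<bar>s\<bar> powr p * (1 + p * (u - 1)) = \<bar>s\<bar> powr p + p * spow (p - 1) s * (t - s)"
  proof -
    have "spow (p - 1) s * s = \<bar>s\<bar> powr p"
      using False powr_mult_base[of "\<bar>s\<bar>" "p - 1"] by (auto simp: spow_def sgn_if abs_if mult_ac)
    then show ?thesis by (simp add: t algebra_simps)
  qed
  finally show ?thesis .
qed

section \<open>The metric projection and orthogonality in the sense of Birkhoff\<close>

text \<open>Summing the tangent inequality over the coordinates makes the linear terms cancel.  The
  conclusion is strict, so it gives optimality and uniqueness of a nearest point at once.\<close>

lemma lp_norm_less_of_orthogonal:
  fixes k z :: "real^'n"
  assumes p: "1 < p" and orth: "(\<Sum>i\<in>UNIV. spow (p - 1) (k $ i) * z $ i) = 0" and z: "z \<noteq> 0"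
  shows "lp_norm p k < lp_norm p (k + z)"
proof -
  have le: "\<bar>k $ i\<bar> powr p + p * (spow (p - 1) (k $ i) * z $ i) \<le> \<bar>(k + z) $ i\<bar> powr p"
    and less: "z $ i \<noteq> 0 \<Longrightarrow>
      \<bar>k $ i\<bar> powr p + p * (spow (p - 1) (k $ i) * z $ i) < \<bar>(k + z) $ i\<bar> powr p" for i
    using abs_powr_tangent[OF p, of "k $ i + z $ i" "k $ i"]
    by (cases "z $ i = 0"; simp add: mult.assoc)+
  obtain i where "z $ i \<noteq> 0" using z by (auto simp: vec_eq_iff)
  then have "(\<Sum>i\<in>UNIV. \<bar>k $ i\<bar> powr p + p * (spow (p - 1) (k $ i) * z $ i))
      < (\<Sum>i\<in>UNIV. \<bar>(k + z) $ i\<bar> powr p)"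
    using le less by (intro sum_strict_mono_ex1) auto
  then have "(\<Sum>i\<in>UNIV. \<bar>k $ i\<bar> powr p) < (\<Sum>i\<in>UNIV. \<bar>(k + z) $ i\<bar> powr p)"
    using orth by (simp add: sum.distrib flip: sum_distrib_left)
  then show ?thesis
    unfolding lp_norm_def using p by (intro powr_less_mono2) (auto intro: sum_nonneg)
qed

text \<open>The first-order condition for a nearest point.  By convexity it is sufficient, so a
  projection is computed by exhibiting a solution \<open>y\<close>.\<close>

lemma metric_proj_eqI:
  fixes x y :: "real^'n"
  assumes p: "1 < p" and L: "subspace L" and y: "y \<in> L"
    and orth: "\<And>z. z \<in> L \<Longrightarrow> (\<Sum>i\<in>UNIV. spow (p - 1) ((x - y) $ i) * z $ i) = 0"
  shows "metric_proj p L x = y"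
proof -
  have less: "lp_norm p (x - y) < lp_norm p (x - z)" if "z \<in> L" "z \<noteq> y" for z
    using lp_norm_less_of_orthogonal[OF p orth, of "y - z"] that y L
    by (simp add: subspace_diff)
  show ?thesis
    unfolding metric_proj_def
  proof (rule the_equality)
    show "y \<in> L \<and> (\<forall>z\<in>L. lp_norm p (x - y) \<le> lp_norm p (x - z))"
      using y less by (metis order.refl less_imp_le)
    fix w assume "w \<in> L \<and> (\<forall>z\<in>L. lp_norm p (x - w) \<le> lp_norm p (x - z))"
    then show "w = y" using less y by (metis leD)
  qed
qed

text \<open>The coordinatewise image \<open>k\<close> of \<open>a\<close> under the inverse of \<open>spow (p - 1)\<close> spans the kernel.  It
  is transversal to the hyperplane because each term of \<open>a \<bullet> k\<close> is
  the product of \<open>a\<^sub>i\<close> and a number of the same sign, so that \<open>a \<bullet> k > 0\<close>.\<close>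

lemma linear_metric_proj_hyperplane:
  fixes a :: "real^'n"
  assumes p: "1 < p" and a: "a \<noteq> 0"
  shows "linear (metric_proj p (orth_compl a))"
proof -
  define k :: "real^'n" where "k = (\<chi> i. spow (1 / (p - 1)) (a $ i))"
  have kc: "spow (p - 1) (k $ i) = a $ i" for i
    using p by (simp add: k_def spow_spow_inverse)
  have "0 < a \<bullet> k"
    using sum_mult_spow_pos[OF a, of "1 / (p - 1)"] by (simp add: inner_vec_def k_def)
  then have ak: "a \<bullet> k \<noteq> 0" by simp
  have "metric_proj p (orth_compl a) x = x - (a \<bullet> x / (a \<bullet> k)) *\<^sub>R k" for x
  proof (rule metric_proj_eqI[OF p])
    show "subspace (orth_compl a)"
      unfolding orth_compl_def by (rule subspace_hyperplane)
    show "x - (a \<bullet> x / (a \<bullet> k)) *\<^sub>R k \<in> orth_compl a"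
      using ak by (simp add: orth_compl_def inner_diff_right)
    fix z assume z: "z \<in> orth_compl a"
    have "(\<Sum>i\<in>UNIV. spow (p - 1) ((x - (x - (a \<bullet> x / (a \<bullet> k)) *\<^sub>R k)) $ i) * z $ i)
        = (\<Sum>i\<in>UNIV. spow (p - 1) (a \<bullet> x / (a \<bullet> k)) * (a $ i * z $ i))"
      using p by (simp add: kc spow_mult mult.assoc del: times_divide_eq_left)
    also have "\<dots> = spow (p - 1) (a \<bullet> x / (a \<bullet> k)) * (a \<bullet> z)"
      by (simp add: inner_vec_def flip: sum_distrib_left)
    also have "\<dots> = 0" using z by (simp add: orth_compl_def)
    finally show "(\<Sum>i\<in>UNIV. spow (p - 1) ((x - (x - (a \<bullet> x / (a \<bullet> k)) *\<^sub>R k)) $ i) * z $ i) = 0" .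
  qed
  then have "metric_proj p (orth_compl a) = (\<lambda>x. x - (a \<bullet> x / (a \<bullet> k)) *\<^sub>R k)" by auto
  then show ?thesis
    by (auto intro!: linearI simp: inner_add_right algebra_simps add_divide_distrib)
qed

section \<open>Metric projections onto lines\<close>

lemma metric_proj_line_eqI:
  fixes c x :: "real^'n"
  assumes p: "1 < p" and "(\<Sum>i\<in>UNIV. spow (p - 1) ((x - t *\<^sub>R c) $ i) * c $ i) = 0"
  shows "metric_proj p (span {c}) x = t *\<^sub>R c"
proof (rule metric_proj_eqI[OF p])
  fix z assume "z \<in> span {c}"
  then obtain s where z: "z = s *\<^sub>R c" by (auto simp: span_singleton)
  have "(\<Sum>i\<in>UNIV. spow (p - 1) ((x - t *\<^sub>R c) $ i) * z $ i)
      = s * (\<Sum>i\<in>UNIV. spow (p - 1) ((x - t *\<^sub>R c) $ i) * c $ i)"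
    by (simp add: z sum_distrib_left mult_ac)
  then show "(\<Sum>i\<in>UNIV. spow (p - 1) ((x - t *\<^sub>R c) $ i) * z $ i) = 0"
    using assms(2) by simp
qed (auto intro: span_mul span_base)

text \<open>A sum of at most two terms vanishes if and only if the sum of their signed powers does, since
  signed powers are odd and injective.  This turns the first-order condition into the linear
  equation \<open>h \<bullet> k = 0\<close>, so \<open>P\<close> is the projection onto the line along the hyperplane \<open>h\<^sup>\<bottom>\<close>.\<close>

lemma linear_metric_proj_line:
  fixes c :: "real^'n"
  assumes p: "1 < p" and c: "c \<noteq> 0" and supp: "card {i. c $ i \<noteq> 0} \<le> 2"
  shows "linear (metric_proj p (span {c}))"
proof -
  define h :: "real^'n" where "h = (\<chi> i. spow (1 / (p - 1)) (c $ i))"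
  have "0 < h \<bullet> c"
    using sum_mult_spow_pos[OF c, of "1 / (p - 1)"] by (simp add: inner_vec_def h_def mult.commute)
  then have hc: "h \<bullet> c \<noteq> 0" by simp
  \<comment> \<open>A support with a single element is the case \<open>j = l\<close>.\<close>
  obtain j l where jl: "j = l \<Longrightarrow> \<forall>i. i \<noteq> j \<longrightarrow> c $ i = 0" "\<And>i. i \<noteq> j \<Longrightarrow> i \<noteq> l \<Longrightarrow> c $ i = 0"
  proof -
    have "{i. c $ i \<noteq> 0} \<noteq> {}" using c by (auto simp: vec_eq_iff)
    then have "card {i. c $ i \<noteq> 0} \<noteq> 0" by simp
    then have "card {i. c $ i \<noteq> 0} = 1 \<or> card {i. c $ i \<noteq> 0} = 2" using supp by linarith
    then obtain j l where "{i. c $ i \<noteq> 0} = {j, l}"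
      by (auto simp: card_1_singleton_iff card_2_iff)
    then show ?thesis by (intro that[of j l]) auto
  qed
  have key: "(\<Sum>i\<in>UNIV. spow (p - 1) (k $ i) * c $ i) = 0" if "h \<bullet> k = 0" for k
  proof -
    have *: "(\<Sum>i\<in>UNIV. f i) = (\<Sum>i\<in>{j, l}. f i)" if "\<And>i. c $ i = 0 \<Longrightarrow> f i = 0" for f :: "'n \<Rightarrow> real"
      using jl that by (intro sum.mono_neutral_right) auto
    have "(\<Sum>i\<in>{j, l}. h $ i * k $ i) = 0"
      using that by (subst *[symmetric]) (auto simp: inner_vec_def h_def)
    then have "(\<Sum>i\<in>{j, l}. spow (p - 1) (h $ i * k $ i)) = 0"
      by (cases "j = l") (auto simp: add_eq_0_iff2)
    then show ?thesis
      using p by (subst *) (simp_all add: spow_mult h_def spow_spow_inverse mult.commute)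
  qed
  have "metric_proj p (span {c}) x = (h \<bullet> x / (h \<bullet> c)) *\<^sub>R c" for x
    using hc by (intro metric_proj_line_eqI[OF p] key) (simp add: inner_diff_right)
  then have "metric_proj p (span {c}) = (\<lambda>x. (h \<bullet> x / (h \<bullet> c)) *\<^sub>R c)" by auto
  then show ?thesis
    by (auto intro!: linearI simp: inner_add_right algebra_simps add_divide_distrib)
qed

text \<open>The kernel of a linear \<open>P\<close> would contain every coordinate vector: those outside the support
  of \<open>c\<close> trivially, the others as linear combinations of solutions of the first-order condition.\<close>

lemma not_linear_metric_proj_line:
  fixes c :: "real^'n"
  assumes p: "1 < p" "p \<noteq> 2" and supp: "3 \<le> card {i. c $ i \<noteq> 0}"
  shows "\<not> linear (metric_proj p (span {c}))"
proof
  define P where "P = metric_proj p (span {c})"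
  define r where "r = 1 / (p - 1)"
  define d where "d i = spow r (1 / c $ i)" for i
  assume "linear (metric_proj p (span {c}))"
  then have lin: "linear P" by (simp add: P_def)
  have r: "spow (p - 1) (spow r s) = s" for s
    using p by (simp add: r_def spow_spow_inverse)
  have ker: "P x = 0" if "(\<Sum>i\<in>UNIV. spow (p - 1) (x $ i) * c $ i) = 0" for x
    using metric_proj_line_eqI[OF p(1), of x 0 c] that by (simp add: P_def)
  \<comment> \<open>The factors \<open>d\<close> normalise \<open>c\<close> away: \<open>c\<^sub>i \<phi>(\<phi>\<^sup>-\<^sup>1(u) d\<^sub>i) = u\<close> for \<open>\<phi> = spow (p - 1)\<close>.\<close>
  have ker3: "P (axis i (spow r u * d i) + axis j (spow r v * d j) + axis l (spow r w * d l)) = 0"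
    if "i \<noteq> j" "i \<noteq> l" "j \<noteq> l" "c $ i \<noteq> 0" "c $ j \<noteq> 0" "c $ l \<noteq> 0" "u + v + w = 0"
    for i j l u v w
  proof (rule ker)
    let ?x = "axis i (spow r u * d i) + axis j (spow r v * d j) + axis l (spow r w * d l)"
    have "(\<Sum>m\<in>UNIV. spow (p - 1) (?x $ m) * c $ m) = (\<Sum>m\<in>{i, j, l}. spow (p - 1) (?x $ m) * c $ m)"
      by (intro sum.mono_neutral_right) (auto simp: axis_def)
    also have "\<dots> = 0"
      using that by (simp add: axis_def d_def spow_mult r)
    finally show "(\<Sum>m\<in>UNIV. spow (p - 1) (?x $ m) * c $ m) = 0" .
  qed
  have Paxis: "P (axis l 1) = 0" for l
  proof (cases "c $ l = 0")
    case True
    then show ?thesis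
      by (intro ker sum.neutral) (auto simp: axis_def)
  next
    case False
    have "card {i. c $ i \<noteq> 0} - 1 = card ({i. c $ i \<noteq> 0} - {l})"
      using False by simp
    then have "2 \<le> card ({i. c $ i \<noteq> 0} - {l})" using supp by linarith
    then obtain T where T: "T \<subseteq> {i. c $ i \<noteq> 0} - {l}" "card T = 2"
      using obtain_subset_with_card_n by metis
    then obtain i j where ij: "i \<noteq> j" "i \<noteq> l" "j \<noteq> l" "c $ i \<noteq> 0" "c $ j \<noteq> 0"
      by (auto simp: card_2_iff)
    note K = ker3[OF ij False]
    define k1 where "k1 = axis i (d i) + axis j 0 + axis l (- d l)"
    define k2 where "k2 = axis i 0 + axis j (d j) + axis l (- d l)"
    define k3 where "k3 = axis i (d i) + axis j (d j) + axis l (- (spow r 2 * d l))"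
    have "P (k1 + k2 - k3) = 0"
      using K[of 1 0 "-1"] K[of 0 1 "-1"] K[of 1 1 "-2"]
      by (simp add: linear_add[OF lin] linear_diff[OF lin] flip: k1_def k2_def k3_def)
    also have "k1 + k2 - k3 = ((spow r 2 - 2) * d l) *\<^sub>R axis l 1"
      by (auto simp: k1_def k2_def k3_def vec_eq_iff axis_def algebra_simps)
    finally have "((spow r 2 - 2) * d l) *\<^sub>R P (axis l 1) = 0"
      by (simp add: linear_scale[OF lin])
    moreover have "spow r 2 \<noteq> 2"
    proof
      assume "spow r 2 = 2"
      then have "2 powr r = 2 powr (1::real)" by (simp add: spow_def)
      then have "r = 1" by (subst (asm) powr_inj) auto
      then show False using p by (simp add: r_def field_simps)
    qed
    moreover have "d l \<noteq> 0"
      using r[of "1 / c $ l"] False by (auto simp: d_def)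
    ultimately show ?thesis by simp
  qed
  have "P c = P (\<Sum>i\<in>UNIV. c $ i *\<^sub>R axis i 1)"
    using basis_expansion[of c] by (simp add: scalar_mult_eq_scaleR)
  also have "\<dots> = 0"
    by (simp add: linear_sum[OF lin] linear_scale[OF lin] Paxis)
  finally have "P c = 0" .
  moreover have "P c = c"
    using metric_proj_line_eqI[OF p(1), of c 1 c] by (simp add: P_def)
  ultimately show False using supp by simp
qed

section \<open>Intersections of two planes\<close>

unbundle cross3_syntax

lemma orth_compl_Int:
  assumes "a \<times> b \<noteq> 0"
  shows "orth_compl a \<inter> orth_compl b = span {a \<times> b}"
proof
  show "orth_compl a \<inter> orth_compl b \<subseteq> span {a \<times> b}"
  proof
    fix x assume "x \<in> orth_compl a \<inter> orth_compl b"
    then have x: "a \<bullet> x = 0" "b \<bullet> x = 0" by (auto simp: orth_compl_def)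
    have "(a \<times> b) \<times> x = (a \<bullet> x) *\<^sub>R b - (b \<bullet> x) *\<^sub>R a"
      by (simp add: cross3_simps forall_3)
    then have "collinear {0, a \<times> b, x}" using x by (simp flip: cross_eq_0)
    then show "x \<in> span {a \<times> b}"
      using assms by (auto simp: collinear_lemma span_singleton)
  qed
  show "span {a \<times> b} \<subseteq> orth_compl a \<inter> orth_compl b"
    by (auto simp: span_singleton orth_compl_def dot_cross_self)
qed

text \<open>The degenerate case of parallel \<open>a\<close> and \<open>b\<close> fits the pattern: the intersection is then a
  plane, whose projection is linear, and all coordinates of the cross product vanish.\<close>

lemma linear_metric_proj_Int_iff:
  fixes a b :: "real^3"
  assumes p: "1 < p" "p \<noteq> 2" and a: "a \<noteq> 0" and b: "b \<noteq> 0"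
  shows "linear (metric_proj p (orth_compl a \<inter> orth_compl b)) \<longleftrightarrow> (\<exists>i. (a \<times> b) $ i = 0)"
proof (cases "a \<times> b = 0")
  case True
  then obtain t where t: "b = t *\<^sub>R a" using a b by (auto simp: cross_eq_0 collinear_lemma)
  then have "orth_compl b = orth_compl a" using b by (auto simp: orth_compl_def)
  then show ?thesis using True linear_metric_proj_hyperplane[OF p(1) a] by simp
next
  case False
  define S where "S = {i. (a \<times> b) $ i \<noteq> 0}"
  have "card S \<le> 2 \<longleftrightarrow> S \<noteq> UNIV"
  proof
    assume "S \<noteq> UNIV"
    then have "card S < card (UNIV :: 3 set)" by (intro psubset_card_mono) auto
    then show "card S \<le> 2" by simp
  qed auto
  moreover have "linear (metric_proj p (span {a \<times> b})) \<longleftrightarrow> card S \<le> 2"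
    using linear_metric_proj_line[OF p(1) False] not_linear_metric_proj_line[OF p, of "a \<times> b"]
    unfolding S_def by fastforce
  ultimately show ?thesis by (auto simp: orth_compl_Int[OF False] S_def)
qed

text \<open>The cone over a great subsphere lies in a hyperplane, which is a Lebesgue null set.\<close>

lemma AE_uniform_sphere_inner_ne_0:
  fixes h :: "real^'n"
  assumes "h \<noteq> 0"
  shows "AE x in uniform_sphere. h \<bullet> x \<noteq> 0"
proof (rule AE_I)
  let ?E = "{x \<in> sphere 0 1. h \<bullet> x = 0}" and ?H = "{x. h \<bullet> x = 0}"
  have H: "?H \<in> sets borel" by measurable
  have "?H \<in> null_sets lebesgue"
    using assms negligible_hyperplane[of h 0] by (simp add: negligible_iff_null_sets)
  then have H0: "?H \<in> null_sets lborel" using H null_sets_completion_iff[of ?H lborel] by simp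
  have "?E = sphere 0 1 \<inter> ?H" by auto
  then show E: "?E \<in> sets uniform_sphere"
    using H by (auto simp: sets_restrict_space)
  have "emeasure lborel {x \<in> ball 0 1. x /\<^sub>R norm x \<in> ?E} \<le> emeasure lborel ?H"
    using H by (intro emeasure_mono) auto
  also have "\<dots> = 0" using H0 by auto
  finally show "emeasure uniform_sphere ?E = 0"
    by (subst emeasure_uniform_sphere[OF E]) simp
qed auto

lemma measurable_cross3 [measurable]:
  fixes f g :: "'a \<Rightarrow> real^3"
  assumes [measurable]: "f \<in> borel_measurable M" "g \<in> borel_measurable M"
  shows "(\<lambda>x. f x \<times> g x) \<in> borel_measurable M"
proof -
  have "continuous_on UNIV (\<lambda>z::(real^3) \<times> (real^3). fst z \<times> snd z)"
    by (intro continuous_on_cross continuous_intros)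
  from borel_measurable_continuous_on[OF this, of "\<lambda>x. (f x, g x)" M]
  show ?thesis by (simp add: borel_prod[symmetric])
qed

text \<open>Apply the null set lemma twice.  The \<open>i\<close>-th coordinate of \<open>x \<times> y\<close> is \<open>(axis i 1 \<times> x) \<bullet> y\<close>,
  and \<open>axis i 1 \<times> x \<noteq> 0\<close> as soon as \<open>x\<close> avoids the coordinate planes.\<close>

lemma AE_uniform_sphere_cross_ne_0:
  "AE z in uniform_sphere \<Otimes>\<^sub>M uniform_sphere. \<forall>i. (fst z \<times> snd z) $ i \<noteq> 0"
proof -
  interpret S: prob_space "uniform_sphere :: (real^3) measure" by (rule prob_space_uniform_sphere)
  interpret pair_sigma_finite "uniform_sphere :: (real^3) measure" "uniform_sphere :: (real^3) measure" ..
  have id: "(\<lambda>x. x) \<in> measurable (uniform_sphere :: (real^3) measure) borel"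
    by (subst measurable_cong_sets[OF sets_uniform_sphere refl]) (intro measurable_restrict_space1 measurable_ident_sets refl)
  note [measurable] = measurable_compose[OF measurable_fst id] measurable_compose[OF measurable_snd id]
  show ?thesis
  proof (rule AE_pair_measure)
    show "{z \<in> space (uniform_sphere \<Otimes>\<^sub>M uniform_sphere). \<forall>i. (fst z \<times> snd z) $ i \<noteq> 0}
        \<in> sets (uniform_sphere \<Otimes>\<^sub>M uniform_sphere)"
      by measurable
    have "AE x in (uniform_sphere :: (real^3) measure). axis i 1 \<bullet> x \<noteq> 0" for i
      by (rule AE_uniform_sphere_inner_ne_0) simp
    then have "AE x in (uniform_sphere :: (real^3) measure). \<forall>i. x $ i \<noteq> 0"
      by (simp add: AE_all_countable inner_axis')
    then show "AE x in uniform_sphere. AE y in uniform_sphere.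
        \<forall>i. (fst (x, y) \<times> snd (x, y)) $ i \<noteq> 0"
    proof eventually_elim
      case (elim x)
      have eq: "(x \<times> y) $ i = (axis i 1 \<times> x) \<bullet> y" for i and y :: "real^3"
        by (metis cross_triple inner_axis inner_commute inner_real_def mult.right_neutral)
      have "axis i 1 \<times> x \<noteq> 0" for i
        using elim by (cases i rule: exhaust_3[THEN disjE]) (auto simp: cross3_simps forall_3 axis_def)
      then have "AE y in uniform_sphere. (axis i 1 \<times> x) \<bullet> y \<noteq> 0" for i
        by (rule AE_uniform_sphere_inner_ne_0)
      then show ?case by (simp add: AE_all_countable eq)
    qed
  qed
qed

unbundle no cross3_syntax

theorem proposition4p2:
  fixes p :: real
    and M :: "'w measure"
    and a b :: "'w \<Rightarrow> real^3"
    and A B :: "'w \<Rightarrow> (real^3) set"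
  assumes "1 < p" "p \<noteq> 2"
    and "prob_space M"
    and "prob_space.indep_var M uniform_sphere a uniform_sphere b"
    and "distr M uniform_sphere a = uniform_sphere"
    and "distr M uniform_sphere b = uniform_sphere"
    and "\<And>\<omega>. A \<omega> = orth_compl (a \<omega>)"
    and "\<And>\<omega>. B \<omega> = orth_compl (b \<omega>)"
  shows "(\<forall>\<omega>\<in>space M. linear (metric_proj p (A \<omega>)) \<and> linear (metric_proj p (B \<omega>))) \<and>
    {\<omega> \<in> space M. linear (metric_proj p (A \<omega> \<inter> B \<omega>))} \<in> sets M \<and>
    measure M {\<omega> \<in> space M. linear (metric_proj p (A \<omega> \<inter> B \<omega>))} = 0"
proof -
  interpret prob_space M by fact
  have a: "a \<in> measurable M uniform_sphere" and b: "b \<in> measurable M uniform_sphere"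
    using assms(4) by (auto simp: indep_var_distribution_eq)
  have nz: "a \<omega> \<noteq> 0" "b \<omega> \<noteq> 0" if "\<omega> \<in> space M" for \<omega>
    using measurable_space[OF a that] measurable_space[OF b that] by auto
  have [measurable]: "a \<in> borel_measurable M" "b \<in> borel_measurable M"
    using a b
    by (auto simp: measurable_cong_sets[OF refl sets_uniform_sphere] measurable_restrict_space2_iff)
  have ab: "(\<lambda>\<omega>. (a \<omega>, b \<omega>)) \<in> measurable M (uniform_sphere \<Otimes>\<^sub>M uniform_sphere)"
    using a b by (rule measurable_Pair)
  let ?E = "{\<omega> \<in> space M. \<exists>i. cross3 (a \<omega>) (b \<omega>) $ i = 0}"
  have E: "{\<omega> \<in> space M. linear (metric_proj p (A \<omega> \<inter> B \<omega>))} = ?E"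
    using linear_metric_proj_Int_iff[OF assms(1,2) nz] assms(7,8) by auto
  have sets: "?E \<in> sets M" by measurable
  have "distr M (uniform_sphere \<Otimes>\<^sub>M uniform_sphere) (\<lambda>\<omega>. (a \<omega>, b \<omega>))
      = uniform_sphere \<Otimes>\<^sub>M uniform_sphere"
    using assms(4,5,6) by (simp add: indep_var_distribution_eq)
  then have "AE z in distr M (uniform_sphere \<Otimes>\<^sub>M uniform_sphere) (\<lambda>\<omega>. (a \<omega>, b \<omega>)).
      \<forall>i. cross3 (fst z) (snd z) $ i \<noteq> 0"
    using AE_uniform_sphere_cross_ne_0 by (simp only:)
  then have "AE \<omega> in M. \<forall>i. cross3 (a \<omega>) (b \<omega>) $ i \<noteq> 0"
    using AE_distrD[OF ab] by fastforce
  then have "AE \<omega> in M. \<omega> \<notin> ?E" by eventually_elim auto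
  then have "measure M ?E = 0" using prob_eq_0[OF sets] by simp
  then show ?thesis
    using E sets linear_metric_proj_hyperplane[OF assms(1) nz(1)]
      linear_metric_proj_hyperplane[OF assms(1) nz(2)] by (simp add: assms(7,8))
qed

end
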